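(* Let $G$ and $H$ be two connected graphs, each of order at least $2$. Then $\mathrm{gp}_{\mathrm d}(G\,\square\,H)>0$ if and only if one of the factors $G,H$ is complete and the other factor has a simplicial vertex. Moreover, for integers $n,m\ge 2$ and a connected graph $H$ of order at least $2$: (i) $\mathrm{gp}_{\mathrm d}(K_n\,\square\,K_m)=\max\{n,m\}$; and (ii) if $H$ is not complete and contains a simplicial vertex, then $\mathrm{gp}_{\mathrm d}(K_n\,\square\,H)=n$.
   Context: All graphs are finite, simple and connected. $K_n$ is the complete graph on $n$ vertices. A vertex is simplicial if its open neighbourhood induces a complete subgraph. The Cartesian product $G\,\square\,H$ has vertex set $V(G)\times V(H)$, with $(g,h)$ and $(g',h')$ adjacent if either $gg'\in E(G)$ and $h=h'$, or $g=g'$ and $hh'\in E(H)$. For a graph $G$ and $X\subseteq V(G)$, vertices $u,v\in V(G)$ are $X$-positionable if for every shortest $u,v$-path $P$ in $G$ we have $V(P)\cap X\subseteq\{u,v\}$. A set $X\subseteq V(G)$ is a dual general position set if every $u,v\in X$ are $X$-positionable and every $u,v\in V(G)\setminus X$ are $X$-positionable. The dual general position number $\mathrm{gp}_{\mathrm d}(G)$ is the cardinality of a largest dual general position set of $G$ (it is $0$ if only the empty set has the property). *)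

theory Defs
  imports "Graph_Theory.Graph_Theory"
begin

text \<open>
  Finite simple undirected graphs are represented as in the Graph Theory library by
  \<^locale>\<open>pair_graph\<close>: finite, loop-free, symmetric digraphs whose arcs are pairs of vertices, so
  an edge is the pair of opposite arcs.  The library notions are stated for
  \<^typ>\<open>('a, 'b) pre_digraph\<close> and are used through the embedding \<^const>\<open>with_proj\<close>.
\<close>

definition connected_graph :: "'a pair_pre_digraph \<Rightarrow> bool" where
  "connected_graph G \<longleftrightarrow> pair_graph G \<and> Digraph_Component.connected (with_proj G)"

abbreviation order :: "'a pair_pre_digraph \<Rightarrow> nat" where
  "order G \<equiv> card (pverts G)"

text \<open>
  \<^const>\<open>complete_digraph\<close>, written \<open>K\<^bsub>n\<^esub>\<close>, is the library's predicate for being a complete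
  (symmetric, loop-free) graph on \<open>n\<close> vertices.
\<close>

definition complete_graph :: "('a, 'b) pre_digraph \<Rightarrow> bool" where
  "complete_graph G \<longleftrightarrow> (\<exists>n. K\<^bsub>n\<^esub> G)"

definition open_neighbourhood :: "'a pair_pre_digraph \<Rightarrow> 'a \<Rightarrow> 'a set" where
  "open_neighbourhood G v = {w \<in> pverts G. (v, w) \<in> parcs G}"

definition simplicial :: "'a pair_pre_digraph \<Rightarrow> 'a \<Rightarrow> bool" where
  "simplicial G v \<longleftrightarrow>
     v \<in> pverts G \<and> complete_graph (with_proj G \<restriction> open_neighbourhood G v)"

definition has_simplicial_vertex :: "'a pair_pre_digraph \<Rightarrow> bool" where
  "has_simplicial_vertex G \<longleftrightarrow> (\<exists>v. simplicial G v)"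

definition cartesian_product ::
  "'a pair_pre_digraph \<Rightarrow> 'b pair_pre_digraph \<Rightarrow> ('a \<times> 'b) pair_pre_digraph"
  (infixl \<open>\<box>\<close> 70) where
  "G \<box> H =
     \<lparr> pverts = pverts G \<times> pverts H,
       parcs = {((g, h), (g', h')) | g h g' h'.
                  (g, g') \<in> parcs G \<and> h = h' \<and> h \<in> pverts H \<or>
                  g = g' \<and> g \<in> pverts G \<and> (h, h') \<in> parcs H} \<rparr>"

text \<open>Paths are given by their nonempty lists of distinct, consecutively adjacent vertices.\<close>

definition path_between :: "'a pair_pre_digraph \<Rightarrow> 'a \<Rightarrow> 'a vwalk \<Rightarrow> 'a \<Rightarrow> bool" where
  "path_between G u p v \<longleftrightarrow> vpath p (with_proj G) \<and> hd p = u \<and> last p = v"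

definition shortest_path :: "'a pair_pre_digraph \<Rightarrow> 'a \<Rightarrow> 'a vwalk \<Rightarrow> 'a \<Rightarrow> bool" where
  "shortest_path G u p v \<longleftrightarrow>
     path_between G u p v \<and> (\<forall>q. path_between G u q v \<longrightarrow> vwalk_length p \<le> vwalk_length q)"

definition positionable :: "'a pair_pre_digraph \<Rightarrow> 'a set \<Rightarrow> 'a \<Rightarrow> 'a \<Rightarrow> bool" where
  "positionable G X u v \<longleftrightarrow> (\<forall>p. shortest_path G u p v \<longrightarrow> set p \<inter> X \<subseteq> {u, v})"

definition dual_general_position_set :: "'a pair_pre_digraph \<Rightarrow> 'a set \<Rightarrow> bool" where
  "dual_general_position_set G X \<longleftrightarrow>
     X \<subseteq> pverts G \<and>
     (\<forall>u\<in>X. \<forall>v\<in>X. positionable G X u v) \<and>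
     (\<forall>u\<in>pverts G - X. \<forall>v\<in>pverts G - X. positionable G X u v)"

text \<open>
  The empty set is always a dual general position set, so for finite graphs the maximum is taken
  over a finite nonempty set of numbers.
\<close>

definition gp\<^sub>d :: "'a pair_pre_digraph \<Rightarrow> nat" where
  "gp\<^sub>d G = Max {card X | X. dual_general_position_set G X}"

end

theory Submission
  imports Defs
begin

text \<open>
  Let \<open>X\<close> be a dual general position set and \<open>(a, b, c)\<close> an induced path on three vertices; it is a
  geodesic, so if \<open>b \<in> X\<close> then exactly one of \<open>a, c\<close> lies in \<open>X\<close>.  In \<open>G \<box> H\<close> a step along \<open>G\<close>
  followed by a step along \<open>H\<close> is such a path.  Hence at a vertex \<open>(g, h) \<in> X\<close> either all
  \<open>G\<close>-neighbours and no \<open>H\<close>-neighbour lie in \<open>X\<close>, or vice versa; by connectedness the same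
  alternative holds along the whole layer, say \<open>V(G) \<times> {h} \<subseteq> X\<close> and the neighbouring layers avoid
  \<open>X\<close>.  Then an induced three-vertex path in \<open>G\<close>, or one in \<open>H\<close> centred at \<open>h\<close>, violates the
  exactly-one rule, so \<open>G\<close> is complete and \<open>h\<close> is simplicial.  A second layer \<open>V(G) \<times> {b}\<close> inside
  \<open>X\<close> would give a geodesic from \<open>(g, h)\<close> through \<open>(g', h)\<close> to \<open>(g', b)\<close> with three vertices in
  \<open>X\<close>; so \<open>X = V(G) \<times> {h}\<close>.  Conversely such a layer is a dual general position set, because a
  walk entering and leaving it can be shortened when \<open>G\<close> is complete and \<open>h\<close> is simplicial.
\<close>

section \<open>Walks and shortest paths\<close>

lemma vwalk_append_iff:
  assumes "p \<noteq> []" "q \<noteq> []"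
  shows "vwalk (p @ q) G \<longleftrightarrow> vwalk p G \<and> vwalk q G \<and> (last p, hd q) \<in> arcs_ends G"
  using assms by (auto simp: vwalk_def vwalk_arcs_append)

lemma length_vwalk_to_vpath_le: "length (vwalk_to_vpath p) \<le> length p"
proof (induct p rule: vwalk_to_vpath_induct3)
  case (in_set x xs)
  then show ?case
    using length_dropWhile_le[of "\<lambda>y. y \<noteq> x" xs] by simp
qed simp_all

text \<open>Cutting repetitions out of a walk gives a path with the same ends that is no longer. So
  minimality among paths extends to walks, and competitors below need not be checked for repeated
  vertices.\<close>

lemma shortest_path_length_le_vwalk:
  assumes "shortest_path G u p v" "vwalk q (with_proj G)" "hd q = u" "last q = v"
  shows "length p \<le> length q"
proof -
  have "path_between G u (vwalk_to_vpath q) v"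
    using assms by (simp add: path_between_def vwalk_to_vpath_hd vwalk_to_vpath_last vwalk_to_vpath_vpath)
  \<comment> \<open>Minimality counts arcs, one fewer than vertices; nonemptiness of both lists
    makes the truncated subtraction harmless.\<close>
  then have "length p - 1 \<le> length (vwalk_to_vpath q) - 1"
    using assms(1) by (simp add: shortest_path_def)
  moreover have "p \<noteq> []" "vwalk_to_vpath q \<noteq> []"
    using assms by (auto simp: shortest_path_def path_between_def vwalk_def vpath_def vwalk_to_vpath_nonempty)
  ultimately have "length p \<le> length (vwalk_to_vpath q)"
    by (cases p; cases "vwalk_to_vpath q") simp_all
  then show ?thesis
    using length_vwalk_to_vpath_le[of q] by simp
qed

lemma shortest_pathI:
  assumes "vwalk p (with_proj G)" "distinct p" "hd p = u" "last p = v"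
    and "\<And>q. vwalk q (with_proj G) \<Longrightarrow> hd q = u \<Longrightarrow> last q = v \<Longrightarrow> length p \<le> length q"
  shows "shortest_path G u p v"
  using assms by (auto simp: shortest_path_def path_between_def vpath_def diff_le_mono)

text \<open>A shorter walk with the ends of \<open>q\<close> could be spliced in between
  \<open>p\<close> and \<open>r\<close> and would shorten the whole path.\<close>

lemma shortest_path_infix:
  assumes "shortest_path G u (p @ q @ r) v" "q \<noteq> []"
  shows "shortest_path G (hd q) q (last q)"
proof (rule shortest_pathI)
  have walk: "vwalk (p @ q @ r) (with_proj G)" "distinct (p @ q @ r)"
    and ends: "hd (p @ q @ r) = u" "last (p @ q @ r) = v"
    using assms by (auto simp: shortest_path_def path_between_def vpath_def)
  then show "vwalk q (with_proj G)" "distinct q"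
    using assms(2) by (auto simp: vwalk_append_iff intro: vwalkI_append_l vwalkI_append_r)
  fix s assume s: "vwalk s (with_proj G)" "hd s = hd q" "last s = last q"
  then have "s \<noteq> []" by auto
  with s walk assms(2) have "vwalk (p @ s @ r) (with_proj G)"
    by (cases "p = []"; cases "r = []") (auto simp: vwalk_append_iff)
  moreover have "hd (p @ s @ r) = u" "last (p @ s @ r) = v"
    using ends s \<open>s \<noteq> []\<close> assms(2) by (auto simp: hd_append last_append)
  ultimately have "length (p @ q @ r) \<le> length (p @ s @ r)"
    by (rule shortest_path_length_le_vwalk[OF assms(1)])
  then show "length q \<le> length s" by simp
qed simp_all

lemma ex_shortest_path:
  assumes "vwalk q (with_proj G)" "hd q = u" "last q = v"
  obtains p where "shortest_path G u p v"
proof -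
  have "path_between G u (vwalk_to_vpath q) v"
    using assms by (simp add: path_between_def vwalk_to_vpath_hd vwalk_to_vpath_last vwalk_to_vpath_vpath)
  from ex_has_least_nat[of "\<lambda>p. path_between G u p v", OF this, of vwalk_length]
  show thesis
    using that by (auto simp: shortest_path_def)
qed

lemma reachable_imp_vwalk:
  assumes "u \<rightarrow>\<^sup>*\<^bsub>G\<^esub> v"
  shows "\<exists>p. vwalk p G \<and> hd p = u \<and> last p = v"
  using assms unfolding reachable_def
proof (induction rule: converse_rtrancl_on_induct)
  case base
  then have "vwalk [v] G" by (simp add: vwalk_def)
  then show ?case by fastforce
next
  case (step u w)
  then obtain p where "vwalk p G" "hd p = w" "last p = v" by blast
  moreover from this have "p \<noteq> []" by auto
  ultimately have "vwalk (u # p) G \<and> hd (u # p) = u \<and> last (u # p) = v"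
    using step by (auto intro: vwalk_consI)
  then show ?case by blast
qed

lemma (in pair_loopfree_digraph) shortest_path_induced:
  assumes "(a, b) \<in> parcs G" "(b, c) \<in> parcs G" "a \<noteq> c" "(a, c) \<notin> parcs G"
  shows "shortest_path G a [a, b, c] c"
proof (rule shortest_pathI)
  show "vwalk [a, b, c] (with_proj G)"
    using assms by (auto simp: vwalk_def dest: in_arcsD1 in_arcsD2)
  show "distinct [a, b, c]"
    using assms by (auto dest: no_loops')
  fix q assume q: "vwalk q (with_proj G)" "hd q = a" "last q = c"
  then have "q \<noteq> []" by auto
  moreover have "q \<noteq> [x]" for x
    using q assms by auto
  moreover have "q \<noteq> [x, y]" for x y
    using q assms by (auto simp: vwalk_def)
  \<comment> \<open>\<open>remdups_adj.cases\<close> serves only as the case split into lists of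
    length 0, 1 and at least 2.\<close>
  ultimately show "length [a, b, c] \<le> length q"
    by (cases q rule: remdups_adj.cases) (auto simp: Suc_le_eq neq_Nil_conv)
qed simp_all

section \<open>Complete graphs, simplicial vertices and products\<close>

lemma (in pair_graph) complete_digraph_iff:
  "K\<^bsub>n\<^esub> (with_proj G) \<longleftrightarrow>
    card (pverts G) = n \<and> (\<forall>u\<in>pverts G. \<forall>v\<in>pverts G. u \<noteq> v \<longrightarrow> (u, v) \<in> parcs G)"
  unfolding complete_digraph_pair_def
  using pair_finite_verts by (auto dest: in_arcsD1 in_arcsD2 no_loops')

lemma (in pair_graph) complete_graph_iff:
  "complete_graph (with_proj G) \<longleftrightarrow>
    (\<forall>u\<in>pverts G. \<forall>v\<in>pverts G. u \<noteq> v \<longrightarrow> (u, v) \<in> parcs G)"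
  by (simp add: complete_graph_def complete_digraph_iff)

lemma (in pair_graph) simplicial_iff:
  "simplicial G v \<longleftrightarrow>
    v \<in> pverts G \<and> (\<forall>a b. (v, a) \<in> parcs G \<longrightarrow> (v, b) \<in> parcs G \<longrightarrow> a \<noteq> b \<longrightarrow> (a, b) \<in> parcs G)"
proof -
  let ?N = "open_neighbourhood G v"
  \<comment> \<open>The induced subgraph is rebuilt as a pair graph, so that
    \<open>complete_graph_iff\<close> applies to it.\<close>
  define N where "N = \<lparr>pverts = ?N, parcs = {e \<in> parcs G. fst e \<in> ?N \<and> snd e \<in> ?N}\<rparr>"
  have restrict_eq: "with_proj G \<restriction> ?N = with_proj N"
    by (simp add: induce_subgraph_def with_proj_def N_def)
  interpret N: pair_graph N
  proof
    show "symmetric (with_proj N)"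
      by (auto simp: symmetric_def N_def sym_def dest: arcs_symmetric)
  qed (use pair_finite_verts pair_finite_arcs in
      \<open>auto simp: N_def open_neighbourhood_def dest: no_loops'\<close>)
  show ?thesis
    unfolding simplicial_def restrict_eq N.complete_graph_iff
    by (auto simp: N_def open_neighbourhood_def dest: in_arcsD2)
qed

lemma (in pair_graph) complete_imp_simplicial:
  assumes "complete_graph (with_proj G)" "v \<in> pverts G"
  shows "simplicial G v"
  using assms by (auto simp: simplicial_iff complete_graph_iff dest: in_arcsD1 in_arcsD2)

section \<open>Connected graphs: reachability, induction along arcs, completeness\<close>

lemma connected_graph_reachable:
  assumes "connected_graph G" "u \<in> pverts G" "v \<in> pverts G"
  shows "u \<rightarrow>\<^sup>*\<^bsub>with_proj G\<^esub> v"
proof -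
  interpret pair_graph G using assms by (simp add: connected_graph_def)
  \<comment> \<open>Connectedness ignores the direction of arcs; symmetry turns it into directed
    reachability.\<close>
  have "strongly_connected (with_proj G)"
    using assms by (intro symmetric_connected_imp_strongly_connected) (auto simp: connected_graph_def)
  then show ?thesis
    using assms by (auto simp: strongly_connected_def)
qed

lemma connected_graph_induct [consumes 3, case_names base step]:
  assumes "connected_graph G" "u \<in> pverts G" "v \<in> pverts G"
    and "P u" "\<And>x y. (x, y) \<in> parcs G \<Longrightarrow> P x \<Longrightarrow> P y"
  shows "P v"
  using connected_graph_reachable[OF assms(1-3)] unfolding reachable_def
  by (induction rule: rtrancl_on_induct) (auto intro: assms(4,5))

lemma connected_graph_ex_neighbour:
  assumes "connected_graph G" "order G \<ge> 2" "u \<in> pverts G"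
  obtains v where "(u, v) \<in> parcs G"
proof -
  interpret pair_graph G using assms by (simp add: connected_graph_def)
  have "\<not> pverts G \<subseteq> {u}"
    using assms(2) card_mono[of "{u}" "pverts G"] by auto
  then obtain w where w: "w \<in> pverts G" "w \<noteq> u" by blast
  \<comment> \<open>A walk from \<open>u\<close> to \<open>w\<close> is trivial or has a first arc,
    and that arc leaves \<open>u\<close>.\<close>
  have "w = u \<or> (\<exists>v. (u, v) \<in> parcs G)"
    using assms(1,3) w(1) by (induction rule: connected_graph_induct) auto
  with w that show thesis by blast
qed

text \<open>Following a walk from \<open>u\<close>, each vertex stays equal or adjacent to
  \<open>u\<close>: a neighbour of a neighbour of \<open>u\<close> is \<open>u\<close> itself or
  adjacent to \<open>u\<close>.\<close>

lemma connected_graph_no_induced_path_imp_complete: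
  assumes "connected_graph G"
    and "\<And>a b c. (a, b) \<in> parcs G \<Longrightarrow> (b, c) \<in> parcs G \<Longrightarrow> a \<noteq> c \<Longrightarrow> (a, c) \<in> parcs G"
  shows "complete_graph (with_proj G)"
proof -
  interpret pair_graph G using assms by (simp add: connected_graph_def)
  have "u = v \<or> (u, v) \<in> parcs G" if "u \<in> pverts G" "v \<in> pverts G" for u v
    using assms(1) that by (induction rule: connected_graph_induct) (auto intro: assms(2))
  then show ?thesis by (auto simp: complete_graph_iff)
qed

lemma complete_imp_connected_graph:
  assumes "K\<^bsub>n\<^esub> (with_proj G)" "n \<ge> 2"
  shows "connected_graph G"
proof -
  interpret pair_graph G using assms(1) by (rule pair_graphI_complete)
  have "u \<rightarrow>\<^sup>*\<^bsub>with_proj G\<^esub> v" if "u \<in> pverts G" "v \<in> pverts G" for u v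
    using assms that by (cases "u = v") (auto simp: complete_digraph_iff)
  moreover have "pverts G \<noteq> {}"
    using assms by (auto simp: complete_digraph_iff)
  ultimately have "Digraph_Component.connected (with_proj G)"
    by (auto simp: connected_conv reachable_def symcl_def
        intro: rtrancl_on_mono[where F = "pverts G" and s = "parcs G"])
  then show ?thesis
    by (simp add: connected_graph_def pair_graph)
qed

section \<open>Cartesian products: exchange of the factors, projection and layers\<close>

lemma pverts_cartesian_product [simp]: "pverts (G \<box> H) = pverts G \<times> pverts H"
  by (simp add: cartesian_product_def)

lemma parcs_cartesian_product [simp]:
  "((g, h), (g', h')) \<in> parcs (G \<box> H) \<longleftrightarrow>
    (g, g') \<in> parcs G \<and> h = h' \<and> h \<in> pverts H \<or> g = g' \<and> g \<in> pverts G \<and> (h, h') \<in> parcs H"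
  by (simp add: cartesian_product_def)

lemma pair_graph_cartesian_product:
  assumes "pair_graph G" "pair_graph H"
  shows "pair_graph (G \<box> H)"
proof -
  interpret G: pair_graph G by fact
  interpret H: pair_graph H by fact
  have verts: "parcs (G \<box> H) \<subseteq> (pverts G \<times> pverts H) \<times> (pverts G \<times> pverts H)"
    by (auto dest: G.in_arcsD1 G.in_arcsD2 H.in_arcsD1 H.in_arcsD2)
  show ?thesis
  proof
    show "finite (parcs (G \<box> H))"
      using finite_subset[OF verts] by simp
    show "symmetric (with_proj (G \<box> H))"
      by (auto simp: symmetric_def sym_def intro: G.arcs_symmetric H.arcs_symmetric)
    show "fst e \<in> pverts (G \<box> H)" "snd e \<in> pverts (G \<box> H)" if "e \<in> parcs (G \<box> H)" for e
      using that verts by auto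
    show "fst e \<noteq> snd e" if "e \<in> parcs (G \<box> H)" for e
      using that by (cases e) (auto dest: G.no_loops' H.no_loops')
  qed simp
qed

text \<open>\<open>prod.swap\<close> is an isomorphism between the two orders of the product.
  Transporting walks, geodesics and dual general position sets along it lets one of two symmetric
  cases be argued only once.\<close>

lemma vwalk_swap:
  assumes "vwalk p (with_proj (G \<box> H))"
  shows "vwalk (map prod.swap p) (with_proj (H \<box> G))"
  using assms
  by (induction p rule: vwalk_arcs.induct) (auto simp: vwalk_def)

lemma shortest_path_swap:
  assumes "shortest_path (G \<box> H) u p v"
  shows "shortest_path (H \<box> G) (prod.swap u) (map prod.swap p) (prod.swap v)"
proof (rule shortest_pathI)
  have p: "vwalk p (with_proj (G \<box> H))" "p \<noteq> []" "distinct p" "hd p = u" "last p = v"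
    using assms by (auto simp: shortest_path_def path_between_def vpath_def)
  then show "vwalk (map prod.swap p) (with_proj (H \<box> G))" "distinct (map prod.swap p)"
    "hd (map prod.swap p) = prod.swap u" "last (map prod.swap p) = prod.swap v"
    by (auto simp: vwalk_swap distinct_map hd_map last_map)
  fix q assume q: "vwalk q (with_proj (H \<box> G))" "hd q = prod.swap u" "last q = prod.swap v"
  then have "length p \<le> length (map prod.swap q)"
    by (intro shortest_path_length_le_vwalk[OF assms]) (auto simp: vwalk_swap hd_map last_map)
  then show "length (map prod.swap p) \<le> length q" by simp
qed

lemma positionable_swap:
  assumes "positionable (G \<box> H) X u v"
  shows "positionable (H \<box> G) (prod.swap ` X) (prod.swap u) (prod.swap v)"
  unfolding positionable_def
proof (intro allI impI)
  fix p assume "shortest_path (H \<box> G) (prod.swap u) p (prod.swap v)"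
  from shortest_path_swap[OF this] have "shortest_path (G \<box> H) u (map prod.swap p) v"
    by simp
  with assms have "set (map prod.swap p) \<inter> X \<subseteq> {u, v}"
    unfolding positionable_def by blast
  then show "set p \<inter> prod.swap ` X \<subseteq> {prod.swap u, prod.swap v}"
    by force
qed

lemma dual_general_position_set_swap:
  assumes "dual_general_position_set (G \<box> H) X"
  shows "dual_general_position_set (H \<box> G) (prod.swap ` X)"
proof -
  have "pverts (H \<box> G) - prod.swap ` X = prod.swap ` (pverts (G \<box> H) - X)"
    by force
  then show ?thesis
    using assms positionable_swap[of G H X]
    by (auto simp: dual_general_position_set_def)
qed

text \<open>Projection to \<open>H\<close> drops the steps along \<open>G\<close>. If the first
  coordinates of the ends differ, there is such a step, so the projection is strictly
  shorter.\<close>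

lemma vwalk_project:
  assumes "vwalk p (with_proj (G \<box> H))"
  shows "\<exists>q. vwalk q (with_proj H) \<and> hd q = snd (hd p) \<and> last q = snd (last p) \<and>
    length q \<le> length p \<and> (fst (hd p) \<noteq> fst (last p) \<longrightarrow> length q < length p)"
  using assms
proof (induction p rule: list.induct)
  case (Cons x p)
  show ?case
  proof (cases "p = []")
    case True
    with Cons.prems show ?thesis
      by (intro exI[of _ "[snd x]"]) (auto simp: vwalk_def)
  next
    case False
    then have p: "vwalk p (with_proj (G \<box> H))" and arc: "(x, hd p) \<in> parcs (G \<box> H)"
      using Cons.prems by (auto elim: vwalk_consE)
    from Cons.IH[OF p] obtain q where q: "vwalk q (with_proj H)" "hd q = snd (hd p)"
      "last q = snd (last p)" "length q \<le> length p"
      "fst (hd p) \<noteq> fst (last p) \<Longrightarrow> length q < length p"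
      by blast
    from arc consider "snd x = snd (hd p)" | "fst x = fst (hd p)" "(snd x, snd (hd p)) \<in> parcs H"
      by (cases x; cases "hd p") auto
    then show ?thesis
    proof cases
      case 1
      with q False show ?thesis by (intro exI[of _ q]) auto
    next
      case 2
      have "q \<noteq> []" using q(1) by auto
      moreover have "snd x \<in> pverts H"
        using Cons.prems by (cases x) (auto simp: vwalk_def)
      then have "vwalk (snd x # q) (with_proj H)"
        using 2 q by (intro vwalk_consI) auto
      ultimately show ?thesis
        using 2 q False by (intro exI[of _ "snd x # q"]) auto
    qed
  qed
qed (auto simp: vwalk_def)

lemma vwalk_layer:
  assumes "vwalk p (with_proj H)" "g \<in> pverts G"
  shows "vwalk (map (Pair g) p) (with_proj (G \<box> H))"
  using assms
  by (induction p rule: vwalk_arcs.induct) (auto simp: vwalk_def)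

text \<open>A competitor must change its first coordinate, so its projection to \<open>H\<close> is
  strictly shorter than itself, yet at least as long as the geodesic \<open>p\<close>.\<close>

lemma shortest_path_step_layer:
  assumes "pair_graph G" "shortest_path H h p b" "(g, g') \<in> parcs G"
  shows "shortest_path (G \<box> H) (g, h) ((g, h) # map (Pair g') p) (g', b)"
proof (rule shortest_pathI)
  interpret G: pair_graph G by fact
  have p: "vwalk p (with_proj H)" "p \<noteq> []" "distinct p" "hd p = h" "last p = b"
    using assms by (auto simp: shortest_path_def path_between_def vpath_def)
  have "h \<in> pverts H" using p by (auto simp: vwalk_def)
  have "g \<noteq> g'" "g \<in> pverts G" "g' \<in> pverts G"
    using assms(3) by (auto dest: G.no_loops' G.in_arcsD1 G.in_arcsD2)
  show "vwalk ((g, h) # map (Pair g') p) (with_proj (G \<box> H))"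
    using p assms(3) \<open>g \<in> _\<close> \<open>g' \<in> _\<close> \<open>h \<in> _\<close>
    by (intro vwalk_consI vwalk_layer) (auto simp: hd_map)
  show "distinct ((g, h) # map (Pair g') p)"
    using p \<open>g \<noteq> g'\<close> by (auto simp: distinct_map inj_on_def)
  show "last ((g, h) # map (Pair g') p) = (g', b)"
    using p by (simp add: last_map)
  fix q assume q: "vwalk q (with_proj (G \<box> H))" "hd q = (g, h)" "last q = (g', b)"
  with vwalk_project[OF q(1)] \<open>g \<noteq> g'\<close> obtain r where
    "vwalk r (with_proj H)" "hd r = h" "last r = b" "length r < length q"
    by auto
  with shortest_path_length_le_vwalk[OF assms(2)]
  show "length ((g, h) # map (Pair g') p) \<le> length q" by fastforce
qed simp

section \<open>Dual general position sets in products\<close>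

text \<open>If \<open>a\<close> and \<open>c\<close> were both in \<open>X\<close> or both outside,
  they would have to be positionable, but the geodesic \<open>[a, b, c]\<close> has its inner vertex
  in \<open>X\<close>.\<close>

lemma (in pair_loopfree_digraph) dual_general_position_set_induced_path:
  assumes "dual_general_position_set G X" "b \<in> X"
    and "(a, b) \<in> parcs G" "(b, c) \<in> parcs G" "a \<noteq> c" "(a, c) \<notin> parcs G"
  shows "a \<in> X \<longleftrightarrow> c \<notin> X"
proof -
  have sp: "shortest_path G a [a, b, c] c"
    using assms by (intro shortest_path_induced)
  have "a \<noteq> b" "b \<noteq> c" using assms by (auto dest: no_loops')
  with sp \<open>b \<in> X\<close> have "\<not> positionable G X a c"
    by (fastforce simp: positionable_def)
  moreover have "a \<in> pverts G" "c \<in> pverts G"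
    using assms by (auto dest: in_arcsD1 in_arcsD2)
  ultimately show ?thesis
    using assms(1) by (auto simp: dual_general_position_set_def)
qed

text \<open>The ends of \<open>(g', h)\<close>, \<open>(g, h)\<close>, \<open>(g, h')\<close> differ
  in both coordinates, so this path is induced.\<close>

lemma dual_general_position_set_product_neighbours:
  assumes "pair_graph G" "pair_graph H" "dual_general_position_set (G \<box> H) X"
    and "(g, h) \<in> X" "(g, g') \<in> parcs G" "(h, h') \<in> parcs H"
  shows "(g', h) \<in> X \<longleftrightarrow> (g, h') \<notin> X"
proof -
  interpret G: pair_graph G by fact
  interpret H: pair_graph H by fact
  interpret GH: pair_graph "G \<box> H"
    by (intro pair_graph_cartesian_product assms)
  show ?thesis
    using assms(5,6)
    by (intro GH.dual_general_position_set_induced_path[OF assms(3,4)])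
      (auto dest: G.arcs_symmetric G.in_arcsD1 H.in_arcsD1 G.no_loops' H.no_loops')
qed

lemma dual_general_position_set_layer:
  assumes "connected_graph G" "order G \<ge> 2" "pair_graph H" "dual_general_position_set (G \<box> H) X"
    and "(g, h) \<in> X" "(h, h0) \<in> parcs H" "(g, h0) \<notin> X" "g' \<in> pverts G"
  shows "(g', h) \<in> X \<and> (\<forall>h'. (h, h') \<in> parcs H \<longrightarrow> (g', h') \<notin> X)"
proof -
  have G: "pair_graph G" using assms by (simp add: connected_graph_def)
  interpret G: pair_graph G by (rule G)
  note neighbours = dual_general_position_set_product_neighbours[OF G assms(3,4)]
  \<comment> \<open>The rule at \<open>(x, h)\<close> puts \<open>(y, h)\<close> into
    \<open>X\<close>. The rule at \<open>(y, h)\<close>, whose neighbour \<open>(x, h)\<close> is in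
    \<open>X\<close>, then excludes every \<open>(y, h')\<close>.\<close>
  have spread: "(y, h) \<in> X \<and> (\<forall>h'. (h, h') \<in> parcs H \<longrightarrow> (y, h') \<notin> X)"
    if "(x, y) \<in> parcs G" "(x, h) \<in> X" "(x, h0) \<notin> X" for x y
  proof -
    have "(y, h) \<in> X"
      using neighbours that assms(6) by blast
    with neighbours that G.arcs_symmetric show ?thesis by blast
  qed
  have g: "g \<in> pverts G"
    using assms(4,5) by (auto simp: dual_general_position_set_def)
  \<comment> \<open>At \<open>g\<close> itself only \<open>h0\<close> is known to give a vertex
    outside \<open>X\<close>; going to a neighbour \<open>x\<close> and back yields this for all
    neighbours of \<open>h\<close>.\<close>
  then obtain x where x: "(g, x) \<in> parcs G"
    using connected_graph_ex_neighbour[OF assms(1,2)] by blast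
  with spread[OF this assms(5,7)] assms(6) have "(x, h) \<in> X" "(x, h0) \<notin> X" by blast+
  from spread[OF G.arcs_symmetric[OF x] this]
  have "(g, h) \<in> X \<and> (\<forall>h'. (h, h') \<in> parcs H \<longrightarrow> (g, h') \<notin> X)" .
  with assms(1) g assms(8) show ?thesis
  proof (induction rule: connected_graph_induct)
    case (step x y)
    then show ?case using spread[of x y] assms(6) by blast
  qed
qed

lemma dual_general_position_set_eq_layer:
  assumes "connected_graph G" "connected_graph H" "order G \<ge> 2" "order H \<ge> 2"
    and "dual_general_position_set (G \<box> H) X"
    and "(g, h) \<in> X" "(h, h0) \<in> parcs H" "(g, h0) \<notin> X"
  shows "complete_graph (with_proj G)" "simplicial H h" "X = pverts G \<times> {h}"
proof -
  have pair: "pair_graph G" "pair_graph H" using assms by (simp_all add: connected_graph_def)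
  interpret G: pair_graph G by (rule pair)
  interpret H: pair_graph H by (rule pair)
  interpret GH: pair_graph "G \<box> H" by (intro pair_graph_cartesian_product pair)
  note neighbours = dual_general_position_set_product_neighbours[OF pair assms(5)]
  note layer = dual_general_position_set_layer[OF assms(1,3) pair(2) assms(5)]
  note layer_h = layer[OF assms(6-8)]
  have sub: "X \<subseteq> pverts G \<times> pverts H"
    using assms(5) by (simp add: dual_general_position_set_def)
  then have g: "g \<in> pverts G" and h: "h \<in> pverts H" using assms(6) by auto
  show "complete_graph (with_proj G)"
  proof (rule connected_graph_no_induced_path_imp_complete[OF assms(1)], rule ccontr)
    fix a b c assume abc: "(a, b) \<in> parcs G" "(b, c) \<in> parcs G" "a \<noteq> c" "(a, c) \<notin> parcs G"
    then have "{a, b, c} \<subseteq> pverts G" by (auto dest: G.in_arcsD1 G.in_arcsD2)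
    then have "(a, h) \<in> X" "(b, h) \<in> X" "(c, h) \<in> X" using layer_h by auto
    moreover have "(a, h) \<in> X \<longleftrightarrow> (c, h) \<notin> X"
      using abc h
      by (intro GH.dual_general_position_set_induced_path[OF assms(5) \<open>(b, h) \<in> X\<close>])
        (auto dest: H.no_loops')
    ultimately show False by simp
  qed
  show "simplicial H h"
    unfolding H.simplicial_iff
  proof (intro conjI allI impI, rule h, rule ccontr)
    fix a b assume ab: "(h, a) \<in> parcs H" "(h, b) \<in> parcs H" "a \<noteq> b" "(a, b) \<notin> parcs H"
    then have "(g, a) \<notin> X" "(g, b) \<notin> X" using layer_h g by auto
    moreover have "(g, a) \<in> X \<longleftrightarrow> (g, b) \<notin> X"
      using ab g H.arcs_symmetric
      by (intro GH.dual_general_position_set_induced_path[OF assms(5) assms(6)])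
        (auto dest: G.no_loops')
    ultimately show False by simp
  qed
  have "b = h" if "(a, b) \<in> X" for a b
  proof (rule ccontr)
    assume "b \<noteq> h"
    have a: "a \<in> pverts G" and b: "b \<in> pverts H" using that sub by auto
    \<comment> \<open>This makes \<open>layer\<close> applicable at \<open>(a, b)\<close>. Otherwise
      \<open>(a', b)\<close> lies outside \<open>X\<close>, and with the factors exchanged the layer
      over \<open>a\<close> is contained in \<open>X\<close>; but \<open>(a, h0)\<close> is not in
      \<open>X\<close>.\<close>
    have "\<exists>b'. (b, b') \<in> parcs H \<and> (a, b') \<notin> X"
    proof (rule ccontr)
      assume *: "\<nexists>b'. (b, b') \<in> parcs H \<and> (a, b') \<notin> X"
      obtain b' where b': "(b, b') \<in> parcs H"
        using connected_graph_ex_neighbour[OF assms(2,4) b] .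
      obtain a' where a': "(a, a') \<in> parcs G"
        using connected_graph_ex_neighbour[OF assms(1,3) a] .
      have "(a', b) \<notin> X"
        using neighbours[OF that a' b'] * b' by blast
      then have "(h0, a) \<in> prod.swap ` X"
        using dual_general_position_set_layer[OF assms(2,4) pair(1)
            dual_general_position_set_swap[OF assms(5)], of b a a' h0] that a' assms(7)
        by (force dest: H.in_arcsD2)
      then show False using layer_h[OF a] assms(7) by auto
    qed
    then obtain b' where b': "(b, b') \<in> parcs H" "(a, b') \<notin> X" by blast
    obtain g' where g': "(g, g') \<in> parcs G"
      using connected_graph_ex_neighbour[OF assms(1,3) g] .
    then have "g' \<in> pverts G" by (rule G.in_arcsD2)
    obtain q where "shortest_path H h q b"
      using reachable_imp_vwalk[OF connected_graph_reachable[OF assms(2) h b]] ex_shortest_path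
      by metis
    \<comment> \<open>Both ends of this geodesic lie in \<open>X\<close>, and so does its second
      vertex \<open>(g', h)\<close>, which is an inner vertex because \<open>b\<close> differs from
      \<open>h\<close>.\<close>
    with pair(1) have sp: "shortest_path (G \<box> H) (g, h) ((g, h) # map (Pair g') q) (g', b)"
      using g' by (intro shortest_path_step_layer)
    have "h \<in> set q"
      using \<open>shortest_path H h q b\<close> by (auto simp: shortest_path_def path_between_def vpath_def)
    moreover have "(g', h) \<in> X" "(g', b) \<in> X"
      using layer_h layer[OF that b'] \<open>g' \<in> pverts G\<close> by auto
    moreover have "g \<noteq> g'" using g' by (auto dest: G.no_loops')
    moreover have "positionable (G \<box> H) X (g, h) (g', b)"
      using assms(5,6) \<open>(g', b) \<in> X\<close> by (simp add: dual_general_position_set_def)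
    then have "set ((g, h) # map (Pair g') q) \<inter> X \<subseteq> {(g, h), (g', b)}"
      using sp unfolding positionable_def by blast
    ultimately show False
      using \<open>b \<noteq> h\<close> by auto
  qed
  then show "X = pverts G \<times> {h}"
    using layer_h sub by auto
qed

text \<open>At a vertex of \<open>X\<close>, take one neighbour along each factor. Exactly one of
  them is in \<open>X\<close>, which decides the direction of the layer; the second direction
  reduces to the first by exchanging the factors.\<close>

lemma dual_general_position_set_productD:
  assumes "connected_graph G" "connected_graph H" "order G \<ge> 2" "order H \<ge> 2"
    and "dual_general_position_set (G \<box> H) X" "X \<noteq> {}"
  shows "complete_graph (with_proj G) \<and> has_simplicial_vertex H \<and> card X = order G \<or>
    complete_graph (with_proj H) \<and> has_simplicial_vertex G \<and> card X = order H"
proof -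
  obtain g h where gh: "(g, h) \<in> X" using assms(6) by auto
  have gh_verts: "g \<in> pverts G" "h \<in> pverts H"
    using gh assms(5) by (auto simp: dual_general_position_set_def)
  obtain g' where g': "(g, g') \<in> parcs G"
    using connected_graph_ex_neighbour[OF assms(1,3) gh_verts(1)] .
  obtain h' where h': "(h, h') \<in> parcs H"
    using connected_graph_ex_neighbour[OF assms(2,4) gh_verts(2)] .
  show ?thesis
  proof (cases "(g, h') \<in> X")
    case False
    note layer = dual_general_position_set_eq_layer[OF assms(1-5) gh h' False]
    have "card X = order G" unfolding layer(3) by (simp add: card_cartesian_product)
    with layer(1,2) show ?thesis by (auto simp: has_simplicial_vertex_def)
  next
    case True
    then have "(g', h) \<notin> X"
      using dual_general_position_set_product_neighbours[OF _ _ assms(5) gh g' h'] assms(1,2)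
      by (simp add: connected_graph_def)
    then have "(h, g) \<in> prod.swap ` X" "(h, g') \<notin> prod.swap ` X" using gh by auto
    note layer = dual_general_position_set_eq_layer[OF assms(2,1,4,3)
        dual_general_position_set_swap[OF assms(5)] this(1) g' this(2)]
    have "card X = card (prod.swap ` X)" by (simp add: card_image)
    also have "\<dots> = order H" unfolding layer(3) by (simp add: card_cartesian_product)
    finally show ?thesis using layer(1,2) by (auto simp: has_simplicial_vertex_def)
  qed
qed

text \<open>Vertices of the layer are equal or adjacent, so geodesics between them have no inner
  vertex. A geodesic with ends outside that met the layer could be shortened by going around it
  through neighbours of \<open>h\<close>.\<close>

lemma dual_general_position_set_complete_layer:
  assumes "pair_graph G" "complete_graph (with_proj G)" "pair_graph H" "simplicial H h"
  shows "dual_general_position_set (G \<box> H) (pverts G \<times> {h})"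
proof -
  interpret G: pair_graph G by fact
  interpret H: pair_graph H by fact
  let ?X = "pverts G \<times> {h}"
  have h: "h \<in> pverts H"
    and clique: "\<And>a b. (h, a) \<in> parcs H \<Longrightarrow> (h, b) \<in> parcs H \<Longrightarrow> a \<noteq> b \<Longrightarrow> (a, b) \<in> parcs H"
    using assms(4) by (auto simp: H.simplicial_iff)
  have complete: "(a, b) \<in> parcs G" if "a \<in> pverts G" "b \<in> pverts G" "a \<noteq> b" for a b
    using assms(2) that by (auto simp: G.complete_graph_iff)
  have "positionable (G \<box> H) ?X (a, h) (b, h)" if ab: "a \<in> pverts G" "b \<in> pverts G" for a b
    unfolding positionable_def
  proof (intro allI impI)
    fix p assume p: "shortest_path (G \<box> H) (a, h) p (b, h)"
    have ends: "p \<noteq> []" "hd p = (a, h)" "last p = (b, h)"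
      using p by (auto simp: shortest_path_def path_between_def vpath_def)
    have "length p \<le> 2"
    proof (cases "a = b")
      case True
      then show ?thesis
        using shortest_path_length_le_vwalk[OF p, of "[(a, h)]"] ab h by (simp add: vwalk_def)
    next
      case False
      then show ?thesis
        using shortest_path_length_le_vwalk[OF p, of "[(a, h), (b, h)]"] ab h complete
        by (simp add: vwalk_def)
    qed
    with ends have "set p \<subseteq> {(a, h), (b, h)}"
      by (cases p rule: remdups_adj.cases) auto
    then show "set p \<inter> ?X \<subseteq> {(a, h), (b, h)}" by blast
  qed
  moreover have "set p \<inter> ?X = {}" if p: "shortest_path (G \<box> H) u p v"
    and uv: "u \<notin> ?X" "v \<notin> ?X" for u v p
  proof (rule ccontr)
    assume "set p \<inter> ?X \<noteq> {}"
    then have ex: "\<exists>x\<in>set p. x \<in> ?X" by blast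
    have walk: "vwalk p (with_proj (G \<box> H))" "distinct p" "hd p = u" "last p = v"
      using p by (auto simp: shortest_path_def path_between_def vpath_def)
    \<comment> \<open>\<open>x\<close> is the first and \<open>y\<close> below the last vertex of
      \<open>p\<close> in the layer, possibly the same; \<open>a\<close> precedes \<open>x\<close>
      and \<open>c\<close> follows \<open>y\<close>.\<close>
    from split_list_first_propE[OF ex] obtain as x bs
      where first: "p = as @ x # bs" "x \<in> ?X" "\<forall>y\<in>set as. y \<notin> ?X" by blast
    with walk uv have "as \<noteq> []" by auto
    then obtain as' a where as: "as = as' @ [a]" by (cases as rule: rev_cases) auto
    have "\<exists>y\<in>set (x # bs). y \<in> ?X" using first by auto
    from split_list_last_propE[OF this] obtain cs y ds
      where last: "x # bs = cs @ y # ds" "y \<in> ?X" "\<forall>z\<in>set ds. z \<notin> ?X" by blast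
    with walk uv first have "ds \<noteq> []" by (auto simp: last_append)
    then obtain c ds' where ds: "ds = c # ds'" by (cases ds) auto
    let ?q = "a # cs @ [y, c]"
    have p_eq: "p = as' @ ?q @ ds'" using first last as ds by simp
    have q: "shortest_path (G \<box> H) a ?q c"
      using shortest_path_infix[of _ _ as' ?q ds'] p p_eq by simp
    have walk_q: "vwalk (a # cs @ [y, c]) (with_proj (G \<box> H))" "a \<noteq> c"
      using q by (auto simp: shortest_path_def path_between_def vpath_def)
    have a: "(a, x) \<in> parcs (G \<box> H)"
      using walk_q last(1) by (cases cs) (auto simp: vwalk_def)
    have c: "(y, c) \<in> parcs (G \<box> H)"
      using vwalkI_append_r[of "[y, c]" "a # cs" "with_proj (G \<box> H)"] walk_q(1)
      by (simp add: vwalk_def)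
    obtain a1 a2 c1 c2 where ac: "a = (a1, a2)" "c = (c1, c2)" by force
    have verts: "a1 \<in> pverts G" "c1 \<in> pverts G" "a2 \<in> pverts H" "c2 \<in> pverts H"
      using walk_q ac by (auto simp: vwalk_def)
    have "a \<notin> ?X" "c \<notin> ?X"
      using first(3) last(3) as ds by auto
    \<comment> \<open>Entering or leaving the layer changes only the second coordinate, so
      \<open>x\<close> and \<open>y\<close> inherit their first coordinates from \<open>a\<close>
      and \<open>c\<close>.\<close>
    with a c first(2) last(2) verts ac have x: "x = (a1, h)" and y: "y = (c1, h)"
      and arcs: "(h, a2) \<in> parcs H" "(h, c2) \<in> parcs H"
      by (auto dest: H.arcs_symmetric)
    note short = shortest_path_length_le_vwalk[OF q]
    show False
    proof (cases "a1 = c1")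
      case True
      with walk_q ac arcs clique have "vwalk [a, c] (with_proj (G \<box> H))"
        using verts by (auto simp: vwalk_def)
      then show False using short[of "[a, c]"] by simp
    next
      case False
      \<comment> \<open>Now \<open>x\<close> and \<open>y\<close> differ, so \<open>?q\<close> has
        at least four vertices, more than the detour through \<open>(c1, a2)\<close>.\<close>
      then have "cs \<noteq> []" using last(1) x y by (cases cs) auto
      show False
      proof (cases "a2 = c2")
        case True
        with False ac complete verts have "vwalk [a, c] (with_proj (G \<box> H))"
          by (auto simp: vwalk_def)
        then show False using short[of "[a, c]"] by simp
      next
        case a2: False
        with False ac complete verts clique arcs
        have "vwalk [a, (c1, a2), c] (with_proj (G \<box> H))"
          by (auto simp: vwalk_def)
        then show False using short[of "[a, (c1, a2), c]"] \<open>cs \<noteq> []\<close> by (cases cs) auto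
      qed
    qed
  qed
  ultimately show ?thesis
    using h by (auto simp: dual_general_position_set_def positionable_def)
qed

section \<open>The dual general position number and its values on products\<close>

lemma dual_general_position_set_empty: "dual_general_position_set G {}"
  by (simp add: dual_general_position_set_def positionable_def)

lemma finite_dual_general_position_cards:
  assumes "finite (pverts G)"
  shows "finite {card X | X. dual_general_position_set G X}"
proof (rule finite_subset)
  show "{card X | X. dual_general_position_set G X} \<subseteq> card ` Pow (pverts G)"
    by (auto simp: dual_general_position_set_def)
qed (use assms in simp)

lemma card_le_gp\<^sub>d:
  assumes "finite (pverts G)" "dual_general_position_set G X"
  shows "card X \<le> gp\<^sub>d G"
  unfolding gp\<^sub>d_def
  using assms by (intro Max_ge finite_dual_general_position_cards) auto

lemma gp\<^sub>d_attained:
  assumes "finite (pverts G)"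
  obtains X where "dual_general_position_set G X" "card X = gp\<^sub>d G"
proof -
  have "gp\<^sub>d G \<in> {card X | X. dual_general_position_set G X}"
    unfolding gp\<^sub>d_def
    using assms dual_general_position_set_empty
    by (intro Max_in finite_dual_general_position_cards) auto
  then show thesis using that by auto
qed

lemma order_le_gp\<^sub>d_complete_left:
  assumes "pair_graph G" "pair_graph H" "complete_graph (with_proj G)" "has_simplicial_vertex H"
  shows "order G \<le> gp\<^sub>d (G \<box> H)"
proof -
  interpret G: pair_graph G by fact
  interpret H: pair_graph H by fact
  obtain h where "simplicial H h" using assms(4) by (auto simp: has_simplicial_vertex_def)
  with assms have "dual_general_position_set (G \<box> H) (pverts G \<times> {h})"
    by (intro dual_general_position_set_complete_layer)
  from card_le_gp\<^sub>d[OF _ this] show ?thesis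
    by (simp add: G.pair_finite_verts H.pair_finite_verts)
qed

lemma order_le_gp\<^sub>d_complete_right:
  assumes "pair_graph G" "pair_graph H" "complete_graph (with_proj H)" "has_simplicial_vertex G"
  shows "order H \<le> gp\<^sub>d (G \<box> H)"
proof -
  interpret G: pair_graph G by fact
  interpret H: pair_graph H by fact
  obtain g where "simplicial G g" using assms(4) by (auto simp: has_simplicial_vertex_def)
  with assms have "dual_general_position_set (G \<box> H) (prod.swap ` (pverts H \<times> {g}))"
    by (intro dual_general_position_set_swap dual_general_position_set_complete_layer)
  from card_le_gp\<^sub>d[OF _ this] show ?thesis
    by (simp add: card_image G.pair_finite_verts H.pair_finite_verts)
qed

text \<open>A positive maximum is attained by a nonempty set, which is a layer; its size gives the
  value along with the structure of the factors.\<close>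

lemma gp\<^sub>d_productD:
  assumes "connected_graph G" "connected_graph H" "order G \<ge> 2" "order H \<ge> 2"
    and "gp\<^sub>d (G \<box> H) > 0"
  shows "complete_graph (with_proj G) \<and> has_simplicial_vertex H \<and> gp\<^sub>d (G \<box> H) = order G \<or>
    complete_graph (with_proj H) \<and> has_simplicial_vertex G \<and> gp\<^sub>d (G \<box> H) = order H"
proof -
  interpret G: pair_graph G using assms by (simp add: connected_graph_def)
  interpret H: pair_graph H using assms by (simp add: connected_graph_def)
  obtain X where X: "dual_general_position_set (G \<box> H) X" "card X = gp\<^sub>d (G \<box> H)"
    using gp\<^sub>d_attained[of "G \<box> H"] by (auto simp: G.pair_finite_verts H.pair_finite_verts)
  with assms(5) have "X \<noteq> {}" by auto
  from dual_general_position_set_productD[OF assms(1-4) X(1) this] X(2) show ?thesis by simp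
qed

lemma gp\<^sub>d_product_pos_iff:
  assumes "connected_graph G" "connected_graph H" "order G \<ge> 2" "order H \<ge> 2"
  shows "gp\<^sub>d (G \<box> H) > 0 \<longleftrightarrow>
    complete_graph (with_proj G) \<and> has_simplicial_vertex H \<or>
    complete_graph (with_proj H) \<and> has_simplicial_vertex G"
  using gp\<^sub>d_productD[OF assms] order_le_gp\<^sub>d_complete_left[of G H]
    order_le_gp\<^sub>d_complete_right[of G H] assms
  by (auto simp: connected_graph_def)

text \<open>The layer over a simplicial vertex makes the number positive, and noncompleteness of
  \<open>H\<close> leaves only the first alternative of \<open>gp\<^sub>d_productD\<close>.\<close>

lemma gp\<^sub>d_complete_product_noncomplete:
  assumes "K\<^bsub>n\<^esub> (with_proj K)" "n \<ge> 2" "connected_graph H" "order H \<ge> 2"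
    and "\<not> complete_graph (with_proj H)" "has_simplicial_vertex H"
  shows "gp\<^sub>d (K \<box> H) = n"
proof -
  interpret pair_graph K using assms(1) by (rule pair_graphI_complete)
  have K: "connected_graph K" "order K = n" "complete_graph (with_proj K)"
    using assms complete_imp_connected_graph complete_digraph_iff
    by (auto simp: complete_graph_def)
  then have "n \<le> gp\<^sub>d (K \<box> H)"
    using order_le_gp\<^sub>d_complete_left[of K H] assms by (simp add: connected_graph_def)
  with gp\<^sub>d_productD[of K H] K assms show ?thesis by auto
qed

text \<open>In a complete graph every vertex is simplicial, so layers in both directions bound the
  number from below; as it equals \<open>n\<close> or \<open>m\<close>, it is the larger
  one.\<close>

lemma gp\<^sub>d_complete_product_complete:
  assumes "K\<^bsub>n\<^esub> (with_proj K)" "n \<ge> 2" "K\<^bsub>m\<^esub> (with_proj L)" "m \<ge> 2"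
  shows "gp\<^sub>d (K \<box> L) = max n m"
proof -
  interpret K: pair_graph K using assms(1) by (rule pair_graphI_complete)
  interpret L: pair_graph L using assms(3) by (rule pair_graphI_complete)
  have K: "connected_graph K" "order K = n" "complete_graph (with_proj K)"
    using assms complete_imp_connected_graph K.complete_digraph_iff
    by (auto simp: complete_graph_def)
  have L: "connected_graph L" "order L = m" "complete_graph (with_proj L)"
    using assms complete_imp_connected_graph L.complete_digraph_iff
    by (auto simp: complete_graph_def)
  have "pverts K \<noteq> {}" "pverts L \<noteq> {}" using K L assms by auto
  then have "has_simplicial_vertex K" "has_simplicial_vertex L"
    using K L K.complete_imp_simplicial L.complete_imp_simplicial
    by (auto simp: has_simplicial_vertex_def)
  then have "n \<le> gp\<^sub>d (K \<box> L)" "m \<le> gp\<^sub>d (K \<box> L)"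
    using order_le_gp\<^sub>d_complete_left[of K L] order_le_gp\<^sub>d_complete_right[of K L] K L
    by (simp_all add: connected_graph_def)
  with gp\<^sub>d_productD[of K L] K L assms show ?thesis by auto
qed

theorem theorem4p6:
  shows
    "(\<forall>(G :: 'a pair_pre_digraph) (H :: 'b pair_pre_digraph).
        connected_graph G \<and> connected_graph H \<and> order G \<ge> 2 \<and> order H \<ge> 2 \<longrightarrow>
        (gp\<^sub>d (G \<box> H) > 0 \<longleftrightarrow>
          complete_graph (with_proj G) \<and> has_simplicial_vertex H \<or>
          complete_graph (with_proj H) \<and> has_simplicial_vertex G)) \<and>
     (\<forall>n m (K :: 'a pair_pre_digraph) (L :: 'b pair_pre_digraph).
        n \<ge> 2 \<and> m \<ge> 2 \<and> K\<^bsub>n\<^esub> (with_proj K) \<and> K\<^bsub>m\<^esub> (with_proj L) \<longrightarrow>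
        gp\<^sub>d (K \<box> L) = max n m) \<and>
     (\<forall>n (K :: 'a pair_pre_digraph) (H :: 'b pair_pre_digraph).
        n \<ge> 2 \<and> K\<^bsub>n\<^esub> (with_proj K) \<and> connected_graph H \<and> order H \<ge> 2 \<and>
        \<not> complete_graph (with_proj H) \<and> has_simplicial_vertex H \<longrightarrow>
        gp\<^sub>d (K \<box> H) = n)"
  using gp\<^sub>d_product_pos_iff gp\<^sub>d_complete_product_complete
    gp\<^sub>d_complete_product_noncomplete
  by (intro conjI allI impI) blast+

end
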